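(* Let $R$ be a commutative ring with unity, let $\{a_{n}\}_{n\geq 0}$ be a sequence of elements of $R$, and let $S=\sum_{i\geq 0}a_{i}X^{i}\in R[[X]]$. For every nonnegative integer $k$, $$S^{k}=\sum_{i\geq 0}\mathbf{a}_{i}^{(k)}X^{i},$$ where $\mathbf{a}_{0}^{(k)}=a_{0}^{k}\binom{k}{0}$ and, for $n\ge 1$, $$\mathbf{a}_{n}^{(k)}=\sum_{p=1}^{n}a_{0}^{k-p}\binom{k}{p}\sum_{\substack{k_1+k_2+\cdots+k_n=p \\ k_1+2k_2+\cdots+nk_n=n}}\frac{p!}{k_{1}!\cdots k_{n}!}\, a_{1}^{k_{1}}\cdots a_{n}^{k_{n}}.$$
   Context: The inner sum is over tuples of nonnegative integers $(k_1,\ldots,k_n)$ satisfying the two displayed conditions. Convention: $a_0^{k-p}\binom{k}{p}$ is $0$ when $p>k$ and is $1$ when $p=k$ (even if $a_0$ is not invertible). Multinomial coefficients are regarded as elements of $R$. *)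

theory Defs
  imports "HOL-Computational_Algebra.Formal_Power_Series"
begin

text \<open>
  A tuple \<open>(k\<^sub>1, \<dots>, k\<^sub>n)\<close> is a function on \<open>{1..n}\<close>, made unique by requiring it to be
  \<open>undefined\<close> outside \<open>{1..n}\<close>.
\<close>

definition weighted_tuples :: "nat \<Rightarrow> nat \<Rightarrow> (nat \<Rightarrow> nat) set" where
  "weighted_tuples n p =
     {\<kappa> \<in> {1..n} \<rightarrow>\<^sub>E UNIV. (\<Sum>i=1..n. \<kappa> i) = p \<and> (\<Sum>i=1..n. i * \<kappa> i) = n}"

text \<open>Finiteness matters because a sum over an infinite set is \<open>0\<close> by convention.\<close>

lemma finite_weighted_tuples: "finite (weighted_tuples n p)"
proof (rule finite_subset)
  show "weighted_tuples n p \<subseteq> {1..n} \<rightarrow>\<^sub>E {..p}"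
  proof
    fix \<kappa> assume \<kappa>: "\<kappa> \<in> weighted_tuples n p"
    have "\<kappa> i \<le> p" if "i \<in> {1..n}" for i
      using \<kappa> member_le_sum[OF that, of \<kappa>] by (simp add: weighted_tuples_def)
    then show "\<kappa> \<in> {1..n} \<rightarrow>\<^sub>E {..p}"
      using \<kappa> by (auto simp: weighted_tuples_def PiE_iff)
  qed
qed (intro finite_PiE; simp)

definition multinomial :: "nat \<Rightarrow> (nat \<Rightarrow> nat) \<Rightarrow> nat" where
  "multinomial n \<kappa> = fact (\<Sum>i=1..n. \<kappa> i) div (\<Prod>i=1..n. fact (\<kappa> i))"

text \<open>The division in \<open>multinomial\<close> is exact.\<close>

lemma multinomial_exact:
  "multinomial n \<kappa> * (\<Prod>i=1..n. fact (\<kappa> i)) = fact (\<Sum>i=1..n. \<kappa> i)"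
proof -
  have "(\<Prod>i=1..n. fact (\<kappa> i)) dvd (fact (\<Sum>i=1..n. \<kappa> i) :: nat)"
  proof (induction n)
    case (Suc n)
    have "(\<Prod>i=1..n. fact (\<kappa> i)) * fact (\<kappa> (Suc n))
            dvd fact (\<Sum>i=1..n. \<kappa> i) * (fact (\<kappa> (Suc n)) :: nat)"
      using Suc by (rule mult_dvd_mono) simp
    also have "\<dots> dvd fact ((\<Sum>i=1..n. \<kappa> i) + \<kappa> (Suc n))"
      by (rule fact_fact_dvd_fact)
    finally show ?case by simp
  qed simp
  then show ?thesis by (simp add: multinomial_def)
qed

text \<open>
  The truncated subtraction \<open>k - p\<close> implements the convention on \<open>a\<^sub>0\<^bsup>k-p\<^esup> binom(k,p)\<close>: for \<open>p > k\<close>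
  the binomial coefficient is \<open>0\<close>, and for \<open>p = k\<close> the product is \<open>a 0 ^ 0 * 1 = 1\<close>.
\<close>

definition power_coeff :: "(nat \<Rightarrow> 'a::comm_ring_1) \<Rightarrow> nat \<Rightarrow> nat \<Rightarrow> 'a" where
  "power_coeff a k n =
     (if n = 0 then a 0 ^ k * of_nat (k choose 0)
      else (\<Sum>p=1..n. a 0 ^ (k - p) * of_nat (k choose p) *
              (\<Sum>\<kappa> \<in> weighted_tuples n p.
                 of_nat (multinomial n \<kappa>) * (\<Prod>i=1..n. a i ^ \<kappa> i))))"

end

theory Submission
  imports Defs
begin

text \<open>
  The coefficient of \<open>X\<^sup>n\<close> in \<open>S\<^sup>k\<close> sees only the coefficients \<open>a\<^sub>0, \<dots>, a\<^sub>n\<close> of \<open>S\<close>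
  (\<open>fps_power_nth_cong\<close>), so \<open>S\<close> may be replaced by \<open>a\<^sub>0 + T\<close> with the polynomial
  \<open>T = a\<^sub>1 X + \<dots> + a\<^sub>n X\<^sup>n\<close>. The binomial theorem gives
  \<open>(a\<^sub>0 + T)\<^sup>k = \<Sum>\<^sub>p binom(k,p) a\<^sub>0\<^bsup>k-p\<^esup> T\<^sup>p\<close>, and the multinomial theorem
  (\<open>multinomial_theorem\<close>) writes \<open>T\<^sup>p\<close> as a sum of monomials in which the tuple
  \<open>(k\<^sub>1, \<dots>, k\<^sub>n)\<close> of sum \<open>p\<close> contributes to the exponent \<open>k\<^sub>1 + 2 k\<^sub>2 + \<dots> + n k\<^sub>n\<close>.
  Selecting the exponent \<open>n\<close> leaves the weighted tuples (\<open>fps_sum_power_nth\<close>).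

  For \<open>n \<ge> 1\<close> it remains to compare the ranges of \<open>p\<close>, which is \<open>0, \<dots>, k\<close> in the binomial theorem and
  \<open>1, \<dots>, n\<close> in the claim. For \<open>p > k\<close> the binomial coefficient vanishes. For \<open>p = 0\<close> and for
  \<open>p > n\<close> there are no weighted tuples, because
  \<open>k\<^sub>1 + \<dots> + k\<^sub>n \<le> k\<^sub>1 + 2 k\<^sub>2 + \<dots> + n k\<^sub>n\<close>, and if the left side is zero then so is the right.
\<close>

unbundle fps_syntax

definition sum_tuples :: "nat \<Rightarrow> nat \<Rightarrow> (nat \<Rightarrow> nat) set" where
  "sum_tuples m p = {\<kappa> \<in> {1..m} \<rightarrow>\<^sub>E UNIV. (\<Sum>i=1..m. \<kappa> i) = p}"

lemma finite_sum_tuples: "finite (sum_tuples m p)"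
proof (rule finite_subset)
  show "sum_tuples m p \<subseteq> {1..m} \<rightarrow>\<^sub>E {..p}"
  proof
    fix \<kappa> assume \<kappa>: "\<kappa> \<in> sum_tuples m p"
    have "\<kappa> i \<le> p" if "i \<in> {1..m}" for i
      using \<kappa> member_le_sum[OF that, of \<kappa>] by (simp add: sum_tuples_def)
    then show "\<kappa> \<in> {1..m} \<rightarrow>\<^sub>E {..p}"
      using \<kappa> by (auto simp: sum_tuples_def PiE_iff)
  qed
qed (intro finite_PiE; simp)

lemma weighted_tuples_conv_sum_tuples:
  "weighted_tuples n p = {\<kappa> \<in> sum_tuples n p. (\<Sum>i=1..n. i * \<kappa> i) = n}"
  by (auto simp: weighted_tuples_def sum_tuples_def)

lemma multinomial_cong:
  "(\<And>i. i \<in> {1..n} \<Longrightarrow> \<kappa> i = \<kappa>' i) \<Longrightarrow> multinomial n \<kappa> = multinomial n \<kappa>'"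
  by (simp add: multinomial_def)

text \<open>
  The multinomial coefficient counts choices made one class at a time. The lower entry of the
  binomial coefficient is the sum of the first \<open>m\<close> entries, which is the exponent \<open>q\<close> in
  \<open>(x + y)\<^sup>p = \<Sum>\<^sub>q binom(p,q) x\<^sup>q y\<^bsup>p-q\<^esup>\<close> when \<open>x\<close> stands for the first \<open>m\<close> summands.
\<close>

lemma multinomial_Suc:
  "multinomial (Suc m) \<kappa> = ((\<Sum>i=1..Suc m. \<kappa> i) choose (\<Sum>i=1..m. \<kappa> i)) * multinomial m \<kappa>"
proof -
  define s where "s = (\<Sum>i=1..m. \<kappa> i)"
  define F where "F = (\<Prod>i=1..m. fact (\<kappa> i) :: nat)"
  have "multinomial (Suc m) \<kappa> * (F * fact (\<kappa> (Suc m))) = fact (s + \<kappa> (Suc m))"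
    using multinomial_exact[of "Suc m" \<kappa>] by (simp add: s_def F_def)
  also have "\<dots> = fact s * fact (\<kappa> (Suc m)) * ((s + \<kappa> (Suc m)) choose s)"
    using binomial_fact_lemma[of s "s + \<kappa> (Suc m)"] by simp
  also have "fact s = multinomial m \<kappa> * F"
    using multinomial_exact[of m \<kappa>] by (simp add: s_def F_def)
  finally have "multinomial (Suc m) \<kappa> * (F * fact (\<kappa> (Suc m))) =
      ((s + \<kappa> (Suc m)) choose s) * multinomial m \<kappa> * (F * fact (\<kappa> (Suc m)))"
    by (simp add: mult_ac)
  moreover have "F * fact (\<kappa> (Suc m)) \<noteq> 0"
    by (simp add: F_def)
  ultimately show ?thesis
    by (simp add: s_def)
qed

text \<open>
  A tuple of length \<open>m + 1\<close> and sum \<open>p\<close> is determined by its first \<open>m\<close> entries, whose sum \<open>q\<close>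
  may be any number up to \<open>p\<close>: the last entry must be \<open>p - q\<close>.
\<close>

lemma sum_over_sum_tuples_Suc:
  "(\<Sum>\<kappa> \<in> sum_tuples (Suc m) p. G \<kappa>) =
     (\<Sum>q\<le>p. \<Sum>\<kappa> \<in> sum_tuples m q. G (\<kappa>(Suc m := p - q)))"
proof -
  have "(\<Sum>q\<le>p. \<Sum>\<kappa> \<in> sum_tuples m q. G (\<kappa>(Suc m := p - q))) =
      (\<Sum>(q, \<kappa>) \<in> Sigma {..p} (sum_tuples m). G (\<kappa>(Suc m := p - q)))"
    by (rule sum.Sigma) (auto simp: finite_sum_tuples)
  also have "\<dots> = (\<Sum>\<kappa> \<in> sum_tuples (Suc m) p. G \<kappa>)"
  proof (rule sum.reindex_bij_witness
      [where i = "\<lambda>\<kappa>. (\<Sum>i=1..m. \<kappa> i, \<kappa>(Suc m := undefined))"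
         and j = "\<lambda>(q, \<kappa>). \<kappa>(Suc m := p - q)"])
    fix x assume x: "x \<in> Sigma {..p} (sum_tuples m)"
    obtain q \<kappa> where q\<kappa>: "x = (q, \<kappa>)"
      by (cases x)
    have q: "q \<le> p" "(\<Sum>i=1..m. \<kappa> i) = q" "\<kappa> \<in> {1..m} \<rightarrow>\<^sub>E UNIV"
      using x by (auto simp: q\<kappa> sum_tuples_def)
    have sum_upd: "(\<Sum>i=1..m. (\<kappa>(Suc m := p - q)) i) = q"
      unfolding q(2)[symmetric] by (rule sum.cong) auto
    have "\<kappa> (Suc m) = undefined"
      using q(3) by (auto simp: PiE_iff extensional_def)
    then show "(\<Sum>i=1..m. (case x of (q, \<kappa>) \<Rightarrow> \<kappa>(Suc m := p - q)) i,
        (case x of (q, \<kappa>) \<Rightarrow> \<kappa>(Suc m := p - q))(Suc m := undefined)) = x"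
      using sum_upd by (auto simp: q\<kappa> fun_upd_idem)
    show "(case x of (q, \<kappa>) \<Rightarrow> \<kappa>(Suc m := p - q)) \<in> sum_tuples (Suc m) p"
      using q sum_upd by (auto simp: q\<kappa> sum_tuples_def PiE_iff extensional_def)
    show "G (case x of (q, \<kappa>) \<Rightarrow> \<kappa>(Suc m := p - q)) =
        (case x of (q, \<kappa>) \<Rightarrow> G (\<kappa>(Suc m := p - q)))"
      by (simp add: q\<kappa>)
  next
    fix \<kappa> assume \<kappa>: "\<kappa> \<in> sum_tuples (Suc m) p"
    have p: "(\<Sum>i=1..m. \<kappa> i) + \<kappa> (Suc m) = p" and ext: "\<kappa> \<in> {1..Suc m} \<rightarrow>\<^sub>E UNIV"
      using \<kappa> by (auto simp: sum_tuples_def)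
    show "(case (\<Sum>i=1..m. \<kappa> i, \<kappa>(Suc m := undefined)) of
        (q, \<kappa>) \<Rightarrow> \<kappa>(Suc m := p - q)) = \<kappa>"
      using p by (auto simp: fun_upd_idem)
    have "(\<Sum>i=1..m. (\<kappa>(Suc m := undefined)) i) = (\<Sum>i=1..m. \<kappa> i)"
      by (rule sum.cong) auto
    moreover have "\<kappa>(Suc m := undefined) \<in> {1..m} \<rightarrow>\<^sub>E UNIV"
      using ext by (auto simp: PiE_iff extensional_def)
    ultimately show "(\<Sum>i=1..m. \<kappa> i, \<kappa>(Suc m := undefined)) \<in> Sigma {..p} (sum_tuples m)"
      using p by (auto simp: sum_tuples_def)
  qed
  finally show ?thesis ..
qed

text \<open>
  Induction on the number of summands: split off the last one with the binomial theorem. The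
  recursion for multinomial coefficients matches the binomial coefficient that appears.
\<close>

theorem multinomial_theorem:
  fixes f :: "nat \<Rightarrow> 'a::comm_semiring_1"
  shows "(\<Sum>i=1..m. f i) ^ p =
           (\<Sum>\<kappa> \<in> sum_tuples m p. of_nat (multinomial m \<kappa>) * (\<Prod>i=1..m. f i ^ \<kappa> i))"
proof (induction m arbitrary: p)
  case 0
  have "sum_tuples 0 p = (if p = 0 then {\<lambda>_. undefined} else {})"
    by (auto simp: sum_tuples_def)
  then show ?case
    by (simp add: multinomial_def power_0_left)
next
  case (Suc m)
  have step: "of_nat (multinomial (Suc m) (\<kappa>(Suc m := p - q))) *
        (\<Prod>i=1..Suc m. f i ^ (\<kappa>(Suc m := p - q)) i) =
      of_nat (p choose q) * (of_nat (multinomial m \<kappa>) * (\<Prod>i=1..m. f i ^ \<kappa> i)) *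
        f (Suc m) ^ (p - q)"
    if "q \<le> p" "\<kappa> \<in> sum_tuples m q" for q \<kappa>
  proof -
    let ?\<kappa> = "\<kappa>(Suc m := p - q)"
    have "(\<Sum>i=1..m. ?\<kappa> i) = (\<Sum>i=1..m. \<kappa> i)"
      by (rule sum.cong) auto
    then have "(\<Sum>i=1..m. ?\<kappa> i) = q"
      using that(2) by (simp add: sum_tuples_def)
    moreover have "multinomial m ?\<kappa> = multinomial m \<kappa>"
      by (rule multinomial_cong) auto
    ultimately have mult: "multinomial (Suc m) ?\<kappa> = (p choose q) * multinomial m \<kappa>"
      using that(1) by (simp add: multinomial_Suc)
    have "(\<Prod>i=1..m. f i ^ ?\<kappa> i) = (\<Prod>i=1..m. f i ^ \<kappa> i)"
      by (rule prod.cong) auto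
    then have "(\<Prod>i=1..Suc m. f i ^ ?\<kappa> i) = (\<Prod>i=1..m. f i ^ \<kappa> i) * f (Suc m) ^ (p - q)"
      by simp
    then show ?thesis
      by (simp only: mult of_nat_mult mult.assoc)
  qed
  have "(\<Sum>i=1..Suc m. f i) ^ p = ((\<Sum>i=1..m. f i) + f (Suc m)) ^ p"
    by simp
  also have "\<dots> = (\<Sum>q\<le>p. of_nat (p choose q) * (\<Sum>i=1..m. f i) ^ q * f (Suc m) ^ (p - q))"
    by (rule binomial_ring)
  also have "\<dots> = (\<Sum>q\<le>p. \<Sum>\<kappa> \<in> sum_tuples m q.
      of_nat (multinomial (Suc m) (\<kappa>(Suc m := p - q))) *
        (\<Prod>i=1..Suc m. f i ^ (\<kappa>(Suc m := p - q)) i))"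
    unfolding Suc.IH sum_distrib_left sum_distrib_right
    by (intro sum.cong refl) (simp only: step atMost_iff)
  also have "\<dots> = (\<Sum>\<kappa> \<in> sum_tuples (Suc m) p.
      of_nat (multinomial (Suc m) \<kappa>) * (\<Prod>i=1..Suc m. f i ^ \<kappa> i))"
    by (rule sum_over_sum_tuples_Suc[symmetric])
  finally show ?case .
qed

text \<open>
  In the multinomial expansion each tuple yields a constant multiple of a single power of \<open>X\<close>,
  so taking a coefficient amounts to filtering the tuples by their weighted sum.
\<close>

lemma fps_sum_power_nth:
  fixes a :: "nat \<Rightarrow> 'a::comm_ring_1"
  shows "(\<Sum>i=1..n. fps_const (a i) * fps_X ^ i) ^ p $ n =
           (\<Sum>\<kappa> \<in> weighted_tuples n p.
              of_nat (multinomial n \<kappa>) * (\<Prod>i=1..n. a i ^ \<kappa> i))"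
proof -
  have monomial: "(of_nat (multinomial n \<kappa>) *
        (\<Prod>i=1..n. (fps_const (a i) * fps_X ^ i) ^ \<kappa> i)) $ n =
      (if (\<Sum>i=1..n. i * \<kappa> i) = n
       then of_nat (multinomial n \<kappa>) * (\<Prod>i=1..n. a i ^ \<kappa> i) else 0)" for \<kappa>
  proof -
    have const: "(\<Prod>i=1..n. fps_const (a i ^ \<kappa> i)) = fps_const (\<Prod>i=1..n. a i ^ \<kappa> i)"
      by (induction n) (simp_all add: mult.commute)
    have "of_nat (multinomial n \<kappa>) * (\<Prod>i=1..n. (fps_const (a i) * fps_X ^ i) ^ \<kappa> i) =
        fps_const (of_nat (multinomial n \<kappa>)) * ((\<Prod>i=1..n. fps_const (a i ^ \<kappa> i)) *
          (\<Prod>i=1..n. fps_X ^ (i * \<kappa> i)))"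
      by (simp add: power_mult_distrib prod.distrib fps_of_nat flip: power_mult)
    also have "\<dots> = fps_const (of_nat (multinomial n \<kappa>) * (\<Prod>i=1..n. a i ^ \<kappa> i)) *
        fps_X ^ (\<Sum>i=1..n. i * \<kappa> i)"
      by (simp only: const power_sum mult.assoc flip: fps_const_mult)
    finally show ?thesis
      by (simp only: fps_mult_left_const_nth fps_X_power_nth) auto
  qed
  show ?thesis
    unfolding multinomial_theorem fps_sum_nth monomial weighted_tuples_conv_sum_tuples
    by (rule sum.inter_filter[symmetric]) (rule finite_sum_tuples)
qed

lemma fps_power_nth_cong:
  fixes f g :: "'a::comm_semiring_1 fps"
  assumes "\<And>i. i \<le> n \<Longrightarrow> f $ i = g $ i" and "i \<le> n"
  shows "f ^ k $ i = g ^ k $ i"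
  using assms(2)
proof (induction k arbitrary: i)
  case (Suc k)
  then show ?case
    using assms(1) by (simp add: fps_mult_nth)
qed simp

text \<open>
  Every weight \<open>i\<close> is at least \<open>1\<close>, so the sum of a tuple is at most its weighted sum; and a
  tuple with sum \<open>0\<close> has weighted sum \<open>0\<close>.
\<close>

lemma weighted_tuples_empty:
  assumes "0 < n" and "p = 0 \<or> n < p"
  shows "weighted_tuples n p = {}"
proof (rule equals0I)
  fix \<kappa> assume "\<kappa> \<in> weighted_tuples n p"
  then have p: "(\<Sum>i=1..n. \<kappa> i) = p" and n: "(\<Sum>i=1..n. i * \<kappa> i) = n"
    by (auto simp: weighted_tuples_def)
  have "(\<Sum>i=1..n. \<kappa> i) \<le> (\<Sum>i=1..n. i * \<kappa> i)"
    by (rule sum_mono) auto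
  moreover have "(\<Sum>i=1..n. i * \<kappa> i) = 0" if "p = 0"
    using p that by simp
  ultimately show False
    using p n assms by auto
qed

theorem theorem1p6:
  fixes a :: "nat \<Rightarrow> 'a::comm_ring_1" and k :: nat
  shows "Abs_fps a ^ k = Abs_fps (\<lambda>i. power_coeff a k i)"
proof (rule fps_ext)
  fix n
  show "Abs_fps a ^ k $ n = Abs_fps (\<lambda>i. power_coeff a k i) $ n"
  proof (cases "n = 0")
    case True
    then show ?thesis
      by (simp add: power_coeff_def fps_nth_power_0)
  next
    case False
    define T where "T = (\<Sum>i=1..n. fps_const (a i) * fps_X ^ i)"
    define W where "W p = (\<Sum>\<kappa> \<in> weighted_tuples n p.
      of_nat (multinomial n \<kappa>) * (\<Prod>i=1..n. a i ^ \<kappa> i))" for p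
    have W0: "W p = 0" if "p = 0 \<or> n < p" for p
      using False that by (simp add: W_def weighted_tuples_empty)
    have T_nth: "T $ i = (if 1 \<le> i \<and> i \<le> n then a i else 0)" for i
      by (simp add: T_def fps_sum_nth fps_X_power_nth if_distrib[of "\<lambda>x. _ * x"] cong: if_cong)
    have "Abs_fps a ^ k $ n = (T + fps_const (a 0)) ^ k $ n"
      by (rule fps_power_nth_cong[of n]) (auto simp: T_nth)
    also have "\<dots> = (\<Sum>p\<le>k. a 0 ^ (k - p) * of_nat (k choose p) * W p)"
      unfolding binomial_ring fps_sum_nth
    proof (rule sum.cong)
      fix p
      have "of_nat (k choose p) * T ^ p * fps_const (a 0) ^ (k - p) =
          fps_const (a 0 ^ (k - p) * of_nat (k choose p)) * T ^ p"
        by (simp add: fps_of_nat fps_const_power mult_ac flip: fps_const_mult)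
      moreover have "T ^ p $ n = W p"
        unfolding T_def W_def by (rule fps_sum_power_nth)
      ultimately show "(of_nat (k choose p) * T ^ p * fps_const (a 0) ^ (k - p)) $ n =
          a 0 ^ (k - p) * of_nat (k choose p) * W p"
        by (simp only: fps_mult_left_const_nth)
    qed simp
    \<comment> \<open>Terms with \<open>p = 0\<close> or \<open>p > n\<close> vanish through \<open>W\<close>, those with \<open>p > k\<close> through the binomial.\<close>
    also have "\<dots> = (\<Sum>p=1..n. a 0 ^ (k - p) * of_nat (k choose p) * W p)"
      by (rule sum.mono_neutral_cong) (auto simp: W0 not_le binomial_eq_0)
    finally show ?thesis
      using False by (simp add: power_coeff_def W_def)
  qed
qed

end
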